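(* Let $n$ be a positive integer and let $T_1,T_2$ be $\mathbb{C}_1$-linear operators on $\mathbb{C}_1^n$. The linear operator $T = e_1 T_1 + e_2 T_2 \in L_1^{n}\times_e L_1^{n}$ is a $\mathbb{C}_2$-nilpotent operator if and only if $T_1$ and $T_2$ are nilpotent operators.
   Context: $\mathbb{C}_1$ is the field of complex numbers (imaginary unit $i_1$). The bicomplex numbers are $\mathbb{C}_2 = \{z_1 + i_2 z_2 : z_1,z_2\in\mathbb{C}_1\}$, a commutative ring with $i_1^2=i_2^2=-1$ and $i_1 i_2 = i_2 i_1$. Put $e_1 = (1+i_1 i_2)/2$ and $e_2 = (1-i_1 i_2)/2$; these satisfy $e_1^2=e_1$, $e_2^2=e_2$, $e_1e_2=0$, $e_1+e_2=1$. Every $\xi = z_1+i_2 z_2\in\mathbb{C}_2$ is written uniquely as $\xi = \xi^- e_1 + \xi^+ e_2$ with $\xi^- = z_1 - i_1 z_2$ and $\xi^+ = z_1 + i_1 z_2$ in $\mathbb{C}_1$. For $\mathbb{C}_1$-linear operators $T_1,T_2$ on $\mathbb{C}_1^n$, the $\mathbb{C}_1$-linear operator $e_1T_1+e_2T_2:\mathbb{C}_2^n\to\mathbb{C}_2^n$ is defined by $$(e_1T_1+e_2T_2)(\xi_1,\dots,\xi_n) = e_1\cdot T_1(\xi_1^-,\dots,\xi_n^-) + e_2\cdot T_2(\xi_1^+,\dots,\xi_n^+).$$ The set of all such operators is denoted $L_1^n\times_e L_1^n$. An operator $T\in L_1^n\times_e L_1^n$ is called $\mathbb{C}_2$-nilpotent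 if $T^k=0$ (the $k$-fold composition) for some positive integer $k$. *)

theory Defs
  imports "HOL-Analysis.Analysis"
begin

text \<open>The element \<open>Bicomplex z1 z2\<close> is $z_1 + i_2 z_2$.\<close>

datatype bicomplex = Bicomplex (bc_fst: complex) (bc_snd: complex)

instantiation bicomplex :: comm_ring_1
begin

definition zero_bicomplex :: bicomplex
  where "0 = Bicomplex 0 0"

definition one_bicomplex :: bicomplex
  where "1 = Bicomplex 1 0"

definition plus_bicomplex :: "bicomplex \<Rightarrow> bicomplex \<Rightarrow> bicomplex"
  where "x + y = Bicomplex (bc_fst x + bc_fst y) (bc_snd x + bc_snd y)"

definition minus_bicomplex :: "bicomplex \<Rightarrow> bicomplex \<Rightarrow> bicomplex"
  where "x - y = Bicomplex (bc_fst x - bc_fst y) (bc_snd x - bc_snd y)"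

definition uminus_bicomplex :: "bicomplex \<Rightarrow> bicomplex"
  where "- x = Bicomplex (- bc_fst x) (- bc_snd x)"

definition times_bicomplex :: "bicomplex \<Rightarrow> bicomplex \<Rightarrow> bicomplex"
  where "x * y = Bicomplex (bc_fst x * bc_fst y - bc_snd x * bc_snd y)
                           (bc_fst x * bc_snd y + bc_snd x * bc_fst y)"

instance
  by standard
    (simp_all add: zero_bicomplex_def one_bicomplex_def plus_bicomplex_def minus_bicomplex_def
      uminus_bicomplex_def times_bicomplex_def algebra_simps)

end

lemmas bicomplex_arith_defs =
  zero_bicomplex_def one_bicomplex_def plus_bicomplex_def minus_bicomplex_def
  uminus_bicomplex_def times_bicomplex_def

definition bc_of_complex :: "complex \<Rightarrow> bicomplex"
  where "bc_of_complex z = Bicomplex z 0"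

definition bc_i1 :: bicomplex
  where "bc_i1 = bc_of_complex \<i>"

definition bc_i2 :: bicomplex
  where "bc_i2 = Bicomplex 0 1"

definition bc_e1 :: bicomplex
  where "bc_e1 = bc_of_complex (1/2) * (1 + bc_i1 * bc_i2)"

definition bc_e2 :: bicomplex
  where "bc_e2 = bc_of_complex (1/2) * (1 - bc_i1 * bc_i2)"

text \<open>The idempotent components $\xi^-$ and $\xi^+$.\<close>

definition bc_minus :: "bicomplex \<Rightarrow> complex"
  where "bc_minus x = bc_fst x - \<i> * bc_snd x"

definition bc_plus :: "bicomplex \<Rightarrow> complex"
  where "bc_plus x = bc_fst x + \<i> * bc_snd x"

lemma bicomplex_eq_i2: "Bicomplex z w = bc_of_complex z + bc_i2 * bc_of_complex w"
  by (simp add: bc_of_complex_def bc_i2_def bicomplex_arith_defs)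

lemma bc_units: "bc_i1 * bc_i1 = -1" "bc_i2 * bc_i2 = -1"
  by (simp_all add: bc_i1_def bc_i2_def bc_of_complex_def bicomplex_arith_defs)

lemma bc_idempotents:
  "bc_e1 * bc_e1 = bc_e1" "bc_e2 * bc_e2 = bc_e2" "bc_e1 * bc_e2 = 0" "bc_e1 + bc_e2 = 1"
  by (simp_all add: bc_e1_def bc_e2_def bc_i1_def bc_i2_def bc_of_complex_def bicomplex_arith_defs)

lemma bc_idempotent_decomposition:
  "x = bc_of_complex (bc_minus x) * bc_e1 + bc_of_complex (bc_plus x) * bc_e2"
  by (cases x)
    (simp add: bc_minus_def bc_plus_def bc_e1_def bc_e2_def bc_i1_def bc_i2_def bc_of_complex_def
      bicomplex_arith_defs field_simps)

lemma bc_idempotent_decomposition_unique: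
  assumes "x = bc_of_complex a * bc_e1 + bc_of_complex b * bc_e2"
  shows "a = bc_minus x" "b = bc_plus x"
  using assms
  by (simp_all add: bc_minus_def bc_plus_def bc_e1_def bc_e2_def bc_i1_def bc_i2_def
      bc_of_complex_def bicomplex_arith_defs field_simps)

text \<open>Restriction of scalars: the action of $\mathbb{C}_1$ on $\mathbb{C}_2^n$.\<close>

definition bc_scale :: "complex \<Rightarrow> bicomplex ^ 'n \<Rightarrow> bicomplex ^ 'n"
  where "bc_scale c x = bc_of_complex c *s x"

definition L1 :: "(complex ^ 'n \<Rightarrow> complex ^ 'n) set"
  where "L1 = {T. Vector_Spaces.linear (*s) (*s) T}"

text \<open>The operator $e_1 T_1 + e_2 T_2$ on $\mathbb{C}_2^n$.\<close>

definition idem_op ::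
    "(complex ^ 'n \<Rightarrow> complex ^ 'n) \<Rightarrow> (complex ^ 'n \<Rightarrow> complex ^ 'n)
      \<Rightarrow> bicomplex ^ 'n \<Rightarrow> bicomplex ^ 'n"
  where "idem_op T1 T2 x =
      bc_e1 *s (\<chi> i. bc_of_complex (T1 (\<chi> j. bc_minus (x $ j)) $ i))
    + bc_e2 *s (\<chi> i. bc_of_complex (T2 (\<chi> j. bc_plus (x $ j)) $ i))"

definition L1_idem_prod :: "(bicomplex ^ 'n \<Rightarrow> bicomplex ^ 'n) set"
  where "L1_idem_prod = {idem_op T1 T2 |T1 T2. T1 \<in> L1 \<and> T2 \<in> L1}"

definition nilpotent_op :: "('a::zero \<Rightarrow> 'a) \<Rightarrow> bool"
  where "nilpotent_op T \<longleftrightarrow> (\<exists>k::nat. k > 0 \<and> T ^^ k = (\<lambda>_. 0))"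

definition C2_nilpotent :: "(bicomplex ^ 'n \<Rightarrow> bicomplex ^ 'n) \<Rightarrow> bool"
  where "C2_nilpotent T \<longleftrightarrow> T \<in> L1_idem_prod \<and> nilpotent_op T"

lemma vector_space_bc_scale: "vector_space bc_scale"
  by standard
    (simp_all add: bc_scale_def vec_eq_iff bc_of_complex_def bicomplex_arith_defs algebra_simps)

lemma linear_idem_op:
  assumes "T1 \<in> L1" "T2 \<in> L1"
  shows "Vector_Spaces.linear bc_scale bc_scale (idem_op T1 T2)"
proof -
  interpret T1: Vector_Spaces.linear "(*s)" "(*s)" T1
    using assms(1) by (simp add: L1_def)
  interpret T2: Vector_Spaces.linear "(*s)" "(*s)" T2
    using assms(2) by (simp add: L1_def)
  interpret B: vector_space bc_scale
    by (rule vector_space_bc_scale)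
  have add: "(\<chi> j. bc_minus ((x + y) $ j)) = (\<chi> j. bc_minus (x $ j)) + (\<chi> j. bc_minus (y $ j))"
    "(\<chi> j. bc_plus ((x + y) $ j)) = (\<chi> j. bc_plus (x $ j)) + (\<chi> j. bc_plus (y $ j))"
    for x y :: "bicomplex ^ 'a"
    by (simp_all add: vec_eq_iff bc_minus_def bc_plus_def bicomplex_arith_defs algebra_simps)
  have scale: "(\<chi> j. bc_minus (bc_scale c x $ j)) = c *s (\<chi> j. bc_minus (x $ j))"
    "(\<chi> j. bc_plus (bc_scale c x $ j)) = c *s (\<chi> j. bc_plus (x $ j))"
    for c and x :: "bicomplex ^ 'a"
    by (simp_all add: vec_eq_iff bc_minus_def bc_plus_def bc_scale_def bc_of_complex_def
        bicomplex_arith_defs algebra_simps)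
  have of_add: "bc_of_complex (a + b) = bc_of_complex a + bc_of_complex b" for a b
    by (simp add: bc_of_complex_def bicomplex_arith_defs)
  have of_mult: "bc_of_complex (a * b) = bc_of_complex a * bc_of_complex b" for a b
    by (simp add: bc_of_complex_def bicomplex_arith_defs)
  show ?thesis
  proof (unfold_locales, goal_cases)
    case (1 x y)
    show ?case
      unfolding idem_op_def add T1.add T2.add
      by (simp add: vec_eq_iff of_add algebra_simps)
  next
    case (2 c x)
    show ?case
      unfolding idem_op_def scale T1.scale T2.scale
      by (simp add: vec_eq_iff of_mult bc_scale_def algebra_simps)
  qed
qed

end

theory Submission
  imports Defs
begin

text \<open>The idempotent components $\xi^-$ and $\xi^+$ identify $\mathbb{C}_2^n$ with
  $\mathbb{C}_1^n \times \mathbb{C}_1^n$ and $e_1 T_1 + e_2 T_2$ with the operator acting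
  componentwise by $T_1$ and $T_2$, so $(e_1 T_1 + e_2 T_2)^k = e_1 T_1^k + e_2 T_2^k$, and this
  vanishes exactly when $T_1^k = 0$ and $T_2^k = 0$. Nilpotency exponents $k$ and $l$ of $T_1$ and
  $T_2$ give the common exponent $k + l$.\<close>

text \<open>Uniqueness of the idempotent decomposition, with the factors in the order used by
  \<open>idem_op\<close>.\<close>

lemma bc_minus_idempotent_decomposition:
  "bc_minus (bc_e1 * bc_of_complex a + bc_e2 * bc_of_complex b) = a"
  by (metis bc_idempotent_decomposition_unique(1) mult.commute)

lemma bc_plus_idempotent_decomposition:
  "bc_plus (bc_e1 * bc_of_complex a + bc_e2 * bc_of_complex b) = b"
  by (metis bc_idempotent_decomposition_unique(2) mult.commute)

lemma bc_minus_idem_op: "(\<chi> j. bc_minus (idem_op T1 T2 x $ j)) = T1 (\<chi> j. bc_minus (x $ j))"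
  by (simp add: idem_op_def vec_eq_iff bc_minus_idempotent_decomposition)

lemma bc_plus_idem_op: "(\<chi> j. bc_plus (idem_op T1 T2 x $ j)) = T2 (\<chi> j. bc_plus (x $ j))"
  by (simp add: idem_op_def vec_eq_iff bc_plus_idempotent_decomposition)

text \<open>Existence of the idempotent decomposition, coordinate by coordinate; this is the case
  \<open>k = 0\<close> of the power formula.\<close>

lemma idem_op_id: "idem_op id id = id"
proof
  fix x :: "bicomplex ^ 'n"
  show "idem_op id id x = id x"
    using bc_idempotent_decomposition
    by (simp add: idem_op_def vec_eq_iff mult.commute)
qed

lemma idem_op_comp: "idem_op S1 S2 \<circ> idem_op T1 T2 = idem_op (S1 \<circ> T1) (S2 \<circ> T2)"
proof
  fix x
  show "(idem_op S1 S2 \<circ> idem_op T1 T2) x = idem_op (S1 \<circ> T1) (S2 \<circ> T2) x"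
    \<comment> \<open>Only the outer operator is unfolded, so that the components of the inner one
      can be rewritten as a whole.\<close>
    unfolding comp_def idem_op_def[of S1] bc_minus_idem_op bc_plus_idem_op
    by (simp add: idem_op_def)
qed

lemma idem_op_funpow: "idem_op T1 T2 ^^ k = idem_op (T1 ^^ k) (T2 ^^ k)"
  by (induction k) (simp_all only: funpow.simps idem_op_id idem_op_comp)

lemma idem_op_eq_zero_iff:
  fixes T1 T2 :: "complex ^ 'n \<Rightarrow> complex ^ 'n"
  shows "idem_op T1 T2 = (\<lambda>_. 0) \<longleftrightarrow> T1 = (\<lambda>_. 0) \<and> T2 = (\<lambda>_. 0)"
proof
  assume zero: "idem_op T1 T2 = (\<lambda>_. 0)"
  have "T1 v = 0 \<and> T2 v = 0" for v
  proof -
    \<comment> \<open>Both idempotent components of this vector are \<open>v\<close>, so it tests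
      \<open>T1\<close> and \<open>T2\<close> at once.\<close>
    define x where "x = (\<chi> j. bc_e1 * bc_of_complex (v $ j) + bc_e2 * bc_of_complex (v $ j))"
    have "(\<chi> j. bc_minus (x $ j)) = v" "(\<chi> j. bc_plus (x $ j)) = v"
      by (simp_all add: x_def bc_minus_idempotent_decomposition bc_plus_idempotent_decomposition)
    with bc_minus_idem_op[of T1 T2 x] bc_plus_idem_op[of T1 T2 x] show ?thesis
      by (simp add: zero vec_eq_iff bc_minus_def bc_plus_def zero_bicomplex_def)
  qed
  then show "T1 = (\<lambda>_. 0) \<and> T2 = (\<lambda>_. 0)"
    by blast
next
  have "bc_of_complex 0 = 0"
    by (simp add: bc_of_complex_def zero_bicomplex_def)
  moreover assume "T1 = (\<lambda>_. 0) \<and> T2 = (\<lambda>_. 0)"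
  ultimately show "idem_op T1 T2 = (\<lambda>_. 0)"
    by (simp add: idem_op_def fun_eq_iff vec_eq_iff)
qed

theorem theorem3p3:
  fixes T1 T2 :: "complex ^ 'n \<Rightarrow> complex ^ 'n"
  assumes "T1 \<in> L1" and "T2 \<in> L1"
  shows "C2_nilpotent (idem_op T1 T2) \<longleftrightarrow> nilpotent_op T1 \<and> nilpotent_op T2"
proof -
  have "idem_op T1 T2 \<in> L1_idem_prod"
    using assms by (auto simp: L1_idem_prod_def)
  then have "C2_nilpotent (idem_op T1 T2) \<longleftrightarrow>
      (\<exists>k>0. T1 ^^ k = (\<lambda>_. 0) \<and> T2 ^^ k = (\<lambda>_. 0))"
    by (simp add: C2_nilpotent_def nilpotent_op_def idem_op_funpow idem_op_eq_zero_iff)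
  also have "\<dots> \<longleftrightarrow> nilpotent_op T1 \<and> nilpotent_op T2"
  proof
    assume "nilpotent_op T1 \<and> nilpotent_op T2"
    then obtain k l where "k > 0" and k: "T1 ^^ k = (\<lambda>_. 0)" and l: "T2 ^^ l = (\<lambda>_. 0)"
      by (auto simp: nilpotent_op_def)
    have "T1 ^^ (k + l) = (\<lambda>_. 0)"
      by (simp add: funpow_add k comp_def)
    moreover have "T2 ^^ (k + l) = (\<lambda>_. 0)"
      \<comment> \<open>The sum is swapped so that the zero map \<open>T2 ^^ l\<close> is applied
        last, as \<open>T1 ^^ k\<close> is above.\<close>
      by (simp add: add.commute[of k] funpow_add l comp_def)
    ultimately show "\<exists>k>0. T1 ^^ k = (\<lambda>_. 0) \<and> T2 ^^ k = (\<lambda>_. 0)"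
      using \<open>k > 0\<close> by (intro exI[of _ "k + l"]) simp
  qed (auto simp: nilpotent_op_def)
  finally show ?thesis .
qed

end
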